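(* Let $\mathcal{C}_0=\mathbb{R}^{N_0}$, $\mathcal{C}_1=\mathbb{R}^{N_1}$, $\mathcal{C}_2=\mathbb{R}^{N_2}$, let $\mathbb{G}:\mathcal{C}_0\to\mathcal{C}_1$ and $\mathbb{C}:\mathcal{C}_1\to\mathcal{C}_2$ be the discrete gradient and discrete curl matrices, with $\mathbb{C}\mathbb{G}=0$, let $\mathbb{H}_0\in\mathbb{R}^{N_0\times N_0}$, $\mathbb{H}_1\in\mathbb{R}^{N_1\times N_1}$ be the symmetric duality matrices, let $b\ge 0$, and let $\mathsf{K}=\mathsf{K}(\mathbf{p},\mathbf{v})$ be a smooth real-valued function on an open subset $U$ of $\mathcal{C}_0\times\mathcal{C}_1$. Define $$\boldsymbol{\rho}=\mathbb{H}_0\mathbf{p}-\frac{\partial\mathsf{K}}{\partial\mathbf{p}},\qquad \mathbf{m}=\mathbb{H}_1\mathbf{v}+\frac{\partial\mathsf{K}}{\partial\mathbf{v}},$$ and assume that $(\mathbf{p},\mathbf{v})\mapsto(\boldsymbol{\rho},\mathbf{v})$ is a diffeomorphism of $U$ onto an open set $W$, so that $\mathbf{p}=\mathbf{p}(\boldsymbol{\rho},\mathbf{v})$ on $W$. Define the Hamiltonian $\mathsf{H}:W\to\mathbb{R}$ by $$\mathsf{H}[\boldsymbol{\rho},\mathbf{v}]=\mathsf{K}(\mathbf{p},\mathbf{v})-\left(\frac{\partial\mathsf{K}}{\partial\mathbf{p}}\right)^{T}\mathbf{p}+\frac12\left(\mathbf{p}^T\mathbb{H}_0\mathbf{p}+\mathbf{v}^T\mathbb{H}_1\mathbf{v}\right),\qquad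 \mathbf{p}=\mathbf{p}(\boldsymbol{\rho},\mathbf{v}).$$ Then: (1) $\dfrac{\partial\mathsf{H}}{\partial\boldsymbol{\rho}}=\mathbf{p}$ and $\dfrac{\partial\mathsf{H}}{\partial\mathbf{v}}=\mathbf{m}$. (2) The evolution rule $\dot{\mathsf{F}}=\{\mathsf{F},\mathsf{H}\}+(\mathsf{F},\mathsf{H})$ for all smooth observables $\mathsf{F}=\mathsf{F}(\boldsymbol{\rho},\mathbf{v})$, with the brackets $\{\cdot,\cdot\}$ and $(\cdot,\cdot)$ given in the context, yields the system $$\frac{d}{dt}\begin{pmatrix}\boldsymbol{\rho}\\ \mathbf{v}\end{pmatrix}=\begin{pmatrix}-b\,\mathbb{G}^T\mathbb{H}_1\mathbb{G} & \mathbb{G}^T\\ -\mathbb{G} & 0\end{pmatrix}\begin{pmatrix}\mathbf{p}\\ \mathbf{m}\end{pmatrix}.$$ (3) Along every solution of this system, the energy dissipation rate is $$\dot{\mathsf{H}}=-b\,\mathbf{p}^T\mathbb{G}^T\mathbb{H}_1\mathbb{G}\,\mathbf{p},$$ and the conservation law $\mathbb{C}\,\dot{\mathbf{v}}=0$ holds.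
   Context: All partial derivatives of scalar functions with respect to vectors are column vectors (gradients). In $\mathsf{H}$, $\partial\mathsf{K}/\partial\mathbf{p}$ is evaluated at $(\mathbf{p}(\boldsymbol{\rho},\mathbf{v}),\mathbf{v})$. For smooth functions $\mathsf{F},\mathsf{G}$ of $(\boldsymbol{\rho},\mathbf{v})\in W\subseteq\mathbb{R}^{N_0}\times\mathbb{R}^{N_1}$ the discrete Poisson bracket is $$\{\mathsf{F},\mathsf{G}\}=\left(\frac{\partial\mathsf{F}}{\partial\mathbf{v}}\right)^T\mathbb{G}\,\frac{\partial\mathsf{G}}{\partial\boldsymbol{\rho}}-\left(\frac{\partial\mathsf{G}}{\partial\mathbf{v}}\right)^T\mathbb{G}\,\frac{\partial\mathsf{F}}{\partial\boldsymbol{\rho}}$$ with the sign convention that the $\mathbf v$-equation generated by the evolution rule is as determined by the bracket $\{\mathsf F,\mathsf G\}_{\mathrm{used}}=-\{\mathsf F,\mathsf G\}$, i.e. the bracket used in the evolution rule is $$\{\mathsf{F},\mathsf{G}\}=\left(\frac{\partial\mathsf{G}}{\partial\mathbf{v}}\right)^T\mathbb{G}\,\frac{\partial\mathsf{F}}{\partial\boldsymbol{\rho}}-\left(\frac{\partial\mathsf{F}}{\partial\mathbf{v}}\right)^T\mathbb{G}\,\frac{\partial\mathsf{G}}{\partial\boldsymbol{\rho}},$$ and the discrete symmetric (dissipative) bracket is $$(\mathsf{F},\mathsf{G})=-b\left(\mathbb{G}\frac{\partial\mathsf{F}}{\partial\boldsymbol{\rho}}\right)^T\mathbb{H}_1\,\mathbb{G}\,\frac{\partial\mathsf{G}}{\partial\boldsymbol{\rho}}.$$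 The system above is the spatially discrete nonlinear acoustic model with discrete pressure $\mathbf{p}$, velocity $\mathbf{v}$, density $\boldsymbol{\rho}$ and momentum $\mathbf{m}$. *)

theory Defs
  imports "HOL-Analysis.Analysis"
begin

section \<open>Smooth maps and diffeomorphisms between open sets\<close>

text \<open>Intended for open \<open>S\<close>: \<open>f\<close> is of class \<open>C\<^sup>k\<close> on \<open>S\<close>, with all directional
  derivatives iterated up to order \<open>k\<close> continuous.\<close>

primrec Ck_on :: "nat \<Rightarrow> 'a::real_normed_vector set \<Rightarrow> ('a \<Rightarrow> 'b::real_normed_vector) \<Rightarrow> bool" where
  "Ck_on 0 S f \<longleftrightarrow> continuous_on S f"
| "Ck_on (Suc k) S f \<longleftrightarrow>
     (\<forall>x\<in>S. f differentiable (at x)) \<and>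
     (\<forall>h. Ck_on k S (\<lambda>x. frechet_derivative f (at x) h))"

definition smooth_on :: "'a::real_normed_vector set \<Rightarrow> ('a \<Rightarrow> 'b::real_normed_vector) \<Rightarrow> bool" where
  "smooth_on S f \<longleftrightarrow> (\<forall>k. Ck_on k S f)"

definition diffeomorphism_onto ::
    "('a::real_normed_vector \<Rightarrow> 'b::real_normed_vector) \<Rightarrow> 'a set \<Rightarrow> 'b set \<Rightarrow> bool" where
  "diffeomorphism_onto f U W \<longleftrightarrow>
     open U \<and> open W \<and> bij_betw f U W \<and> smooth_on U f \<and> smooth_on W (inv_into U f)"


section \<open>Partial gradients\<close>

definition grad_fst :: "('a::real_inner \<times> 'b::real_inner \<Rightarrow> real) \<Rightarrow> 'a \<times> 'b \<Rightarrow> 'a" where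
  "grad_fst F z = (THE D. GDERIV (\<lambda>x. F (x, snd z)) (fst z) :> D)"

definition grad_snd :: "('a::real_inner \<times> 'b::real_inner \<Rightarrow> real) \<Rightarrow> 'a \<times> 'b \<Rightarrow> 'b" where
  "grad_snd F z = (THE D. GDERIV (\<lambda>y. F (fst z, y)) (snd z) :> D)"


section \<open>The discrete acoustic model\<close>

text \<open>States come in two coordinate systems: \<open>(p, v) \<in> U\<close> and \<open>(\<rho>, v) \<in> W\<close>.\<close>

definition discrete_density :: "real^'n0^'n0 \<Rightarrow> ((real^'n0) \<times> (real^'n1) \<Rightarrow> real)
    \<Rightarrow> (real^'n0) \<times> (real^'n1) \<Rightarrow> real^'n0" where
  "discrete_density H0 K = (\<lambda>(p, v). H0 *v p - grad_fst K (p, v))"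

definition momentum :: "real^'n1^'n1 \<Rightarrow> ((real^'n0) \<times> (real^'n1) \<Rightarrow> real)
    \<Rightarrow> (real^'n0) \<times> (real^'n1) \<Rightarrow> real^'n1" where
  "momentum H1 K = (\<lambda>(p, v). H1 *v v + grad_snd K (p, v))"

definition density_velocity :: "real^'n0^'n0 \<Rightarrow> ((real^'n0) \<times> (real^'n1) \<Rightarrow> real)
    \<Rightarrow> (real^'n0) \<times> (real^'n1) \<Rightarrow> (real^'n0) \<times> (real^'n1)" where
  "density_velocity H0 K = (\<lambda>(p, v). (discrete_density H0 K (p, v), v))"

text \<open>The pressure \<open>p(\<rho>, v)\<close> and momentum \<open>m(p(\<rho>, v), v)\<close> as functions on \<open>W\<close>; they are
  meaningful where \<open>density_velocity H0 K\<close> is a bijection from \<open>U\<close> onto \<open>W\<close>.\<close>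

definition pressure_of :: "real^'n0^'n0 \<Rightarrow> ((real^'n0) \<times> (real^'n1) \<Rightarrow> real)
    \<Rightarrow> ((real^'n0) \<times> (real^'n1)) set \<Rightarrow> (real^'n0) \<times> (real^'n1) \<Rightarrow> real^'n0" where
  "pressure_of H0 K U w = fst (inv_into U (density_velocity H0 K) w)"

definition momentum_of :: "real^'n0^'n0 \<Rightarrow> real^'n1^'n1 \<Rightarrow> ((real^'n0) \<times> (real^'n1) \<Rightarrow> real)
    \<Rightarrow> ((real^'n0) \<times> (real^'n1)) set \<Rightarrow> (real^'n0) \<times> (real^'n1) \<Rightarrow> real^'n1" where
  "momentum_of H0 H1 K U w = momentum H1 K (pressure_of H0 K U w, snd w)"

definition hamiltonian :: "real^'n0^'n0 \<Rightarrow> real^'n1^'n1 \<Rightarrow> ((real^'n0) \<times> (real^'n1) \<Rightarrow> real)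
    \<Rightarrow> ((real^'n0) \<times> (real^'n1)) set \<Rightarrow> (real^'n0) \<times> (real^'n1) \<Rightarrow> real" where
  "hamiltonian H0 H1 K U = (\<lambda>(\<rho>, v). let p = pressure_of H0 K U (\<rho>, v) in
     K (p, v) - grad_fst K (p, v) \<bullet> p + 1/2 * (p \<bullet> (H0 *v p) + v \<bullet> (H1 *v v)))"


section \<open>Brackets and dynamics\<close>

text \<open>The sign convention is the one used in the evolution rule.\<close>

definition poisson_bracket :: "real^'n0^'n1 \<Rightarrow> ((real^'n0) \<times> (real^'n1) \<Rightarrow> real)
    \<Rightarrow> ((real^'n0) \<times> (real^'n1) \<Rightarrow> real) \<Rightarrow> (real^'n0) \<times> (real^'n1) \<Rightarrow> real" where
  "poisson_bracket \<G> E F w =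
     grad_snd F w \<bullet> (\<G> *v grad_fst E w) - grad_snd E w \<bullet> (\<G> *v grad_fst F w)"

definition dissipative_bracket :: "real \<Rightarrow> real^'n0^'n1 \<Rightarrow> real^'n1^'n1
    \<Rightarrow> ((real^'n0) \<times> (real^'n1) \<Rightarrow> real) \<Rightarrow> ((real^'n0) \<times> (real^'n1) \<Rightarrow> real)
    \<Rightarrow> (real^'n0) \<times> (real^'n1) \<Rightarrow> real" where
  "dissipative_bracket b \<G> H1 E F w =
     - b * ((\<G> *v grad_fst E w) \<bullet> (H1 *v (\<G> *v grad_fst F w)))"

text \<open>Derivatives are taken within the time interval \<open>T\<close>, hence one-sided at end points that
  belong to \<open>T\<close>.\<close>

definition evolves_by_brackets :: "real \<Rightarrow> real^'n0^'n1 \<Rightarrow> real^'n1^'n1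
    \<Rightarrow> ((real^'n0) \<times> (real^'n1)) set \<Rightarrow> ((real^'n0) \<times> (real^'n1) \<Rightarrow> real)
    \<Rightarrow> real set \<Rightarrow> (real \<Rightarrow> (real^'n0) \<times> (real^'n1)) \<Rightarrow> bool" where
  "evolves_by_brackets b \<G> H1 W H T z \<longleftrightarrow>
     (\<forall>F. smooth_on W F \<longrightarrow>
       (\<forall>t\<in>T. ((\<lambda>s. F (z s)) has_real_derivative
          poisson_bracket \<G> F H (z t) + dissipative_bracket b \<G> H1 F H (z t)) (at t within T)))"

definition block_apply :: "real^'a^'c \<Rightarrow> real^'b^'c \<Rightarrow> real^'a^'d \<Rightarrow> real^'b^'d
    \<Rightarrow> (real^'a) \<times> (real^'b) \<Rightarrow> (real^'c) \<times> (real^'d)" where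
  "block_apply A B C D = (\<lambda>(x, y). (A *v x + B *v y, C *v x + D *v y))"

definition solves_acoustic_system :: "real \<Rightarrow> real^'n0^'n1 \<Rightarrow> real^'n0^'n0 \<Rightarrow> real^'n1^'n1
    \<Rightarrow> ((real^'n0) \<times> (real^'n1) \<Rightarrow> real) \<Rightarrow> ((real^'n0) \<times> (real^'n1)) set
    \<Rightarrow> real set \<Rightarrow> (real \<Rightarrow> (real^'n0) \<times> (real^'n1)) \<Rightarrow> bool" where
  "solves_acoustic_system b \<G> H0 H1 K U T z \<longleftrightarrow>
     (\<forall>t\<in>T. (z has_vector_derivative
        block_apply (- b *\<^sub>R (transpose \<G> ** H1 ** \<G>)) (transpose \<G>) (- \<G>) 0
          (pressure_of H0 K U (z t), momentum_of H0 H1 K U (z t))) (at t within T))"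

end

theory Submission
  imports Defs
begin

text \<open>The Hamiltonian is a Legendre transform. On \<open>W\<close> the definition of the density gives
  \<open>\<partial>K/\<partial>p = H\<^sub>0 p - \<rho>\<close>, and substituting this turns the Hamiltonian into
  \<open>K(p, v) + \<rho> \<bullet> p - p \<bullet> H\<^sub>0 p / 2 + v \<bullet> H\<^sub>1 v / 2\<close> with \<open>p = p(\<rho>, v)\<close>. In this form only first
  derivatives of \<open>K\<close> occur, and \<open>p\<close> is a critical point: the coefficient of \<open>dp\<close> in the
  differential is \<open>\<partial>K/\<partial>p + \<rho> - H\<^sub>0 p = 0\<close>. What remains is \<open>p \<bullet> d\<rho> + m \<bullet> dv\<close>
  (\<open>hamiltonian_has_derivative\<close>), so the partial gradients of the Hamiltonian are \<open>p\<close> and \<open>m\<close>.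

  Given the gradient of \<open>H\<close>, the sum of the two brackets of \<open>F\<close> with \<open>H\<close> is the differential of
  \<open>F\<close> applied to the right-hand side of the system (\<open>brackets_eq_vector_field\<close>). Hence a solution
  satisfies the evolution rule by the chain rule, and conversely the rule for the linear
  observables \<open>w \<mapsto> w \<bullet> e\<close> is the system, component by component. The dissipation rate is the
  chain rule for \<open>F = H\<close>, where the antisymmetric bracket vanishes, and \<open>\<C>\<close> annihilates
  \<open>dv/dt = - \<G> p\<close> because \<open>\<C> \<G> = 0\<close>.\<close>

section \<open>Smooth functions and partial gradients\<close>

lemma smooth_on_imp_differentiable:
  assumes "smooth_on S f" "x \<in> S"
  shows "f differentiable (at x)"
proof -
  have "Ck_on (Suc 0) S f"
    using assms(1) unfolding smooth_on_def by blast
  then show ?thesis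
    using assms(2) by simp
qed

lemma Ck_on_const: "Ck_on k S (\<lambda>x. c)"
  by (induction k arbitrary: c) auto

lemma smooth_on_bounded_linear:
  assumes "bounded_linear f"
  shows "smooth_on S f"
  unfolding smooth_on_def
proof
  fix k
  have D: "(f has_derivative f) (at x)" for x
    using assms by (rule bounded_linear_imp_has_derivative)
  show "Ck_on k S f"
  proof (cases k)
    case 0
    then show ?thesis
      using assms by (simp add: linear_continuous_on)
  next
    case (Suc j)
    have "frechet_derivative f (at x) = f" for x
      using frechet_derivative_at[OF D] by simp
    then show ?thesis
      using D by (auto simp: Suc Ck_on_const differentiable_def)
  qed
qed

lemma GDERIV_THE_eq:
  assumes "GDERIV f x :> D"
  shows "(THE D. GDERIV f x :> D) = D"
proof (rule the_equality)
  fix E assume "GDERIV f x :> E"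
  then have "(\<lambda>h. h \<bullet> E) = (\<lambda>h. h \<bullet> D)"
    using assms unfolding gderiv_def by (rule has_derivative_unique)
  then have "h \<bullet> (E - D) = 0" for h
    by (simp add: inner_diff_right fun_eq_iff)
  then show "E = D"
    by (metis inner_eq_zero_iff right_minus_eq)
qed (fact assms)

lemma partial_gradients_eqI:
  assumes "(F has_derivative (\<lambda>h. a \<bullet> fst h + c \<bullet> snd h)) (at z)"
  shows "grad_fst F z = a" and "grad_snd F z = c"
proof -
  have F: "(F has_derivative (\<lambda>h. a \<bullet> fst h + c \<bullet> snd h)) (at (fst z, snd z))"
    using assms by simp
  have "((\<lambda>x. F (x, snd z)) has_derivative (\<lambda>h. a \<bullet> fst (h, 0::'b) + c \<bullet> snd (h, 0::'b))) (at (fst z))"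
    by (rule has_derivative_compose[where f = "\<lambda>x. (x, snd z)", OF _ F])
       (auto intro!: derivative_eq_intros)
  then have "GDERIV (\<lambda>x. F (x, snd z)) (fst z) :> a"
    by (simp add: gderiv_def inner_commute)
  then show "grad_fst F z = a"
    unfolding grad_fst_def by (rule GDERIV_THE_eq)
  have "((\<lambda>y. F (fst z, y)) has_derivative (\<lambda>h. a \<bullet> fst (0::'a, h) + c \<bullet> snd (0::'a, h))) (at (snd z))"
    by (rule has_derivative_compose[where f = "\<lambda>y. (fst z, y)", OF _ F])
       (auto intro!: derivative_eq_intros)
  then have "GDERIV (\<lambda>y. F (fst z, y)) (snd z) :> c"
    by (simp add: gderiv_def inner_commute)
  then show "grad_snd F z = c"
    unfolding grad_snd_def by (rule GDERIV_THE_eq)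
qed

text \<open>The gradients exist because the differential, expanded in the orthonormal basis, is an inner
  product with a fixed vector; its two components are then the partial gradients.\<close>

lemma has_derivative_partial_gradients:
  fixes F :: "'a::euclidean_space \<times> 'b::euclidean_space \<Rightarrow> real"
  assumes "F differentiable (at z)"
  shows "(F has_derivative (\<lambda>h. grad_fst F z \<bullet> fst h + grad_snd F z \<bullet> snd h)) (at z)"
proof -
  obtain D where D: "(F has_derivative D) (at z)"
    using assms by (auto simp: differentiable_def)
  then have lin: "linear D"
    by (rule has_derivative_linear)
  define g where "g = (\<Sum>e\<in>Basis. D e *\<^sub>R e)"
  have "D h = g \<bullet> h" for h
  proof -
    have "D h = D (\<Sum>e\<in>Basis. (h \<bullet> e) *\<^sub>R e)"
      by (simp add: euclidean_representation)
    also have "\<dots> = (\<Sum>e\<in>Basis. (h \<bullet> e) * D e)"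
      by (simp add: linear_sum[OF lin] linear_scale[OF lin])
    also have "\<dots> = g \<bullet> h"
      by (simp add: g_def inner_sum_left inner_commute[of h] mult.commute)
    finally show ?thesis .
  qed
  then have "D = (\<lambda>h. fst g \<bullet> fst h + snd g \<bullet> snd h)"
    by (auto simp: inner_prod_def)
  with D have F: "(F has_derivative (\<lambda>h. fst g \<bullet> fst h + snd g \<bullet> snd h)) (at z)"
    by simp
  then show ?thesis
    unfolding partial_gradients_eqI[OF F] .
qed

section \<open>The gradient of the Hamiltonian\<close>

lemma inner_symmetric_matrix:
  fixes A :: "real^'n^'n"
  assumes "transpose A = A"
  shows "x \<bullet> (A *v y) = y \<bullet> (A *v x)"
  by (metis assms dot_lmul_matrix inner_commute transpose_matrix_vector)

text \<open>The third identity is the definition of the density read backwards. It expresses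
  \<open>\<partial>K/\<partial>p\<close> as a differentiable function on \<open>W\<close> without any second derivative of \<open>K\<close>.\<close>

lemma density_velocity_inverse:
  assumes "diffeomorphism_onto (density_velocity H0 K) U W" "w \<in> W"
  shows "(pressure_of H0 K U w, snd w) \<in> U"
    and "inv_into U (density_velocity H0 K) w = (pressure_of H0 K U w, snd w)"
    and "grad_fst K (pressure_of H0 K U w, snd w) = H0 *v pressure_of H0 K U w - fst w"
proof -
  let ?\<phi> = "density_velocity H0 K"
  have bij: "bij_betw ?\<phi> U W"
    using assms(1) by (simp add: diffeomorphism_onto_def)
  have inU: "inv_into U ?\<phi> w \<in> U"
    using bij assms(2) by (metis bij_betw_imp_surj_on inv_into_into)
  have eq: "?\<phi> (inv_into U ?\<phi> w) = w"
    using bij assms(2) by (rule bij_betw_inv_into_right)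
  have "snd (?\<phi> x) = snd x" for x
    by (simp add: density_velocity_def case_prod_unfold)
  from this[of "inv_into U ?\<phi> w"] have "snd (inv_into U ?\<phi> w) = snd w"
    by (simp add: eq)
  then show inv: "inv_into U ?\<phi> w = (pressure_of H0 K U w, snd w)"
    by (simp add: prod_eq_iff pressure_of_def)
  with inU show "(pressure_of H0 K U w, snd w) \<in> U"
    by simp
  from eq have "H0 *v pressure_of H0 K U w - grad_fst K (pressure_of H0 K U w, snd w) = fst w"
    unfolding inv by (simp add: prod_eq_iff density_velocity_def discrete_density_def)
  then show "grad_fst K (pressure_of H0 K U w, snd w) = H0 *v pressure_of H0 K U w - fst w"
    by (auto simp: algebra_simps)
qed

text \<open>The map \<open>w \<mapsto> p(w)\<close> is differentiable because it is a component of the inverse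
  diffeomorphism. Symmetry of \<open>H\<^sub>0\<close> is what makes the terms in the differential \<open>P'\<close> of the
  pressure cancel.\<close>

lemma hamiltonian_has_derivative:
  fixes H0 :: "real^'n0^'n0" and H1 :: "real^'n1^'n1"
    and K :: "(real^'n0) \<times> (real^'n1) \<Rightarrow> real"
  assumes H0_sym: "transpose H0 = H0"
    and H1_sym: "transpose H1 = H1"
    and K_smooth: "smooth_on U K"
    and diffeo: "diffeomorphism_onto (density_velocity H0 K) U W"
    and w: "w \<in> W"
  shows "(hamiltonian H0 H1 K U has_derivative
           (\<lambda>h. pressure_of H0 K U w \<bullet> fst h + momentum_of H0 H1 K U w \<bullet> snd h)) (at w)"
proof -
  define P where "P = pressure_of H0 K U"
  define \<psi> where "\<psi> = inv_into U (density_velocity H0 K)"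
  have W: "open W" and \<psi>: "smooth_on W \<psi>"
    using diffeo by (auto simp: diffeomorphism_onto_def \<psi>_def)
  obtain \<psi>' where \<psi>': "(\<psi> has_derivative \<psi>') (at w)"
    using smooth_on_imp_differentiable[OF \<psi> w] by (auto simp: differentiable_def)
  have P_eq: "P = (\<lambda>x. fst (\<psi> x))"
    by (auto simp: P_def pressure_of_def \<psi>_def)
  define P' where "P' = (\<lambda>h. fst (\<psi>' h))"
  have P': "(P has_derivative P') (at w)"
    unfolding P_eq P'_def by (rule has_derivative_fst[OF \<psi>'])
  have K: "(K has_derivative
      (\<lambda>h. grad_fst K (P w, snd w) \<bullet> fst h + grad_snd K (P w, snd w) \<bullet> snd h)) (at (P w, snd w))"
    using density_velocity_inverse(1)[OF diffeo w] unfolding P_def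
    by (intro has_derivative_partial_gradients smooth_on_imp_differentiable[OF K_smooth])
  have KP: "((\<lambda>x. K (P x, snd x)) has_derivative
      (\<lambda>h. grad_fst K (P w, snd w) \<bullet> P' h + grad_snd K (P w, snd w) \<bullet> snd h)) (at w)"
  proof -
    have "((\<lambda>x. (P x, snd x)) has_derivative (\<lambda>h. (P' h, snd h))) (at w)"
      by (intro has_derivative_Pair P' has_derivative_snd has_derivative_ident)
    from has_derivative_compose[OF this K] show ?thesis
      by simp
  qed
  have H0P: "((\<lambda>x. H0 *v P x) has_derivative (\<lambda>h. H0 *v P' h)) (at w)"
    by (rule bounded_linear.has_derivative[OF matrix_vector_mul_bounded_linear P'])
  have H1v: "((\<lambda>x. H1 *v snd x) has_derivative (\<lambda>h. H1 *v snd h)) (at w)"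
    by (intro bounded_linear.has_derivative[OF matrix_vector_mul_bounded_linear]
        has_derivative_snd has_derivative_ident)
  \<comment> \<open>The Hamiltonian after substituting \<open>\<partial>K/\<partial>p = H\<^sub>0 p - \<rho>\<close>.\<close>
  let ?L = "\<lambda>x. K (P x, snd x) + fst x \<bullet> P x - 1/2 * (P x \<bullet> (H0 *v P x))
      + 1/2 * (snd x \<bullet> (H1 *v snd x))"
  have L: "(?L has_derivative (\<lambda>h.
      (grad_fst K (P w, snd w) \<bullet> P' h + grad_snd K (P w, snd w) \<bullet> snd h)
      + (fst w \<bullet> P' h + fst h \<bullet> P w)
      - 1/2 * (P w \<bullet> (H0 *v P' h) + P' h \<bullet> (H0 *v P w))
      + 1/2 * (snd w \<bullet> (H1 *v snd h) + snd h \<bullet> (H1 *v snd w)))) (at w)"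
    by (intro has_derivative_add has_derivative_diff has_derivative_mult_right
        has_derivative_inner KP H0P H1v P' has_derivative_fst has_derivative_snd
        has_derivative_ident)
  have "(\<lambda>h.
      (grad_fst K (P w, snd w) \<bullet> P' h + grad_snd K (P w, snd w) \<bullet> snd h)
      + (fst w \<bullet> P' h + fst h \<bullet> P w)
      - 1/2 * (P w \<bullet> (H0 *v P' h) + P' h \<bullet> (H0 *v P w))
      + 1/2 * (snd w \<bullet> (H1 *v snd h) + snd h \<bullet> (H1 *v snd w)))
      = (\<lambda>h. P w \<bullet> fst h + momentum_of H0 H1 K U w \<bullet> snd h)"
  proof
    fix h
    have g: "grad_fst K (P w, snd w) = H0 *v P w - fst w"
      using density_velocity_inverse(3)[OF diffeo w] by (simp add: P_def)
    have m: "momentum_of H0 H1 K U w = H1 *v snd w + grad_snd K (P w, snd w)"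
      by (simp add: momentum_of_def momentum_def P_def)
    have s0: "P w \<bullet> (H0 *v P' h) = P' h \<bullet> (H0 *v P w)"
      by (rule inner_symmetric_matrix[OF H0_sym])
    have s1: "snd w \<bullet> (H1 *v snd h) = snd h \<bullet> (H1 *v snd w)"
      by (rule inner_symmetric_matrix[OF H1_sym])
    show "(grad_fst K (P w, snd w) \<bullet> P' h + grad_snd K (P w, snd w) \<bullet> snd h)
      + (fst w \<bullet> P' h + fst h \<bullet> P w)
      - 1/2 * (P w \<bullet> (H0 *v P' h) + P' h \<bullet> (H0 *v P w))
      + 1/2 * (snd w \<bullet> (H1 *v snd h) + snd h \<bullet> (H1 *v snd w))
      = P w \<bullet> fst h + momentum_of H0 H1 K U w \<bullet> snd h"
      unfolding s0 s1 g m by (simp add: inner_diff_left inner_diff_right inner_add_left inner_add_right inner_commute)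
  qed
  with L have L': "(?L has_derivative
      (\<lambda>h. P w \<bullet> fst h + momentum_of H0 H1 K U w \<bullet> snd h)) (at w)"
    by simp
  have "?L x = hamiltonian H0 H1 K U x" if "x \<in> W" for x
  proof -
    have g: "grad_fst K (P x, snd x) = H0 *v P x - fst x"
      using density_velocity_inverse(3)[OF diffeo that] by (simp add: P_def)
    have "hamiltonian H0 H1 K U x = K (P x, snd x) - grad_fst K (P x, snd x) \<bullet> P x
        + 1/2 * (P x \<bullet> (H0 *v P x) + snd x \<bullet> (H1 *v snd x))"
      by (simp add: hamiltonian_def P_def Let_def case_prod_unfold)
    then show ?thesis
      unfolding g by (simp add: inner_diff_left inner_commute[of "fst x"] inner_commute[of "H0 *v P x" "P x"] algebra_simps)
  qed
  from has_derivative_transform_within_open[OF L' W w this] show ?thesis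
    by (simp add: P_def)
qed

section \<open>Brackets and the acoustic vector field\<close>

lemma uminus_matrix_vector_mult: "(- A) *v x = - (A *v x)" for A :: "real^'n^'m"
  using matrix_vector_mult_diff_rdistrib[of 0 A x] by simp

lemma block_apply_acoustic:
  fixes \<G> :: "real^'n0^'n1"
  shows "block_apply (- b *\<^sub>R (transpose \<G> ** H1 ** \<G>)) (transpose \<G>) (- \<G>) 0 (p, m)
    = (- b *\<^sub>R (transpose \<G> *v (H1 *v (\<G> *v p))) + transpose \<G> *v m, - (\<G> *v p))"
  by (simp add: block_apply_def uminus_matrix_vector_mult scaleR_matrix_vector_assoc[symmetric]
      matrix_vector_mul_assoc matrix_mul_assoc)

text \<open>The off-diagonal blocks \<open>\<G>\<^sup>T\<close> and \<open>- \<G>\<close> are adjoint up to sign and produce the Poisson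
  bracket; the diagonal block produces the dissipative one.\<close>

lemma brackets_eq_vector_field:
  fixes \<G> :: "real^'n0^'n1"
  shows "poisson_bracket \<G> F H w + dissipative_bracket b \<G> H1 F H w =
    (grad_fst F w, grad_snd F w) \<bullet>
      block_apply (- b *\<^sub>R (transpose \<G> ** H1 ** \<G>)) (transpose \<G>) (- \<G>) 0
        (grad_fst H w, grad_snd H w)"
proof -
  have adj: "x \<bullet> (transpose \<G> *v y) = y \<bullet> (\<G> *v x)" for x y
    by (metis dot_lmul_matrix inner_commute transpose_matrix_vector)
  show ?thesis
    unfolding block_apply_acoustic poisson_bracket_def dissipative_bracket_def
    by (simp add: inner_prod_def inner_add_right inner_diff_right adj inner_commute
        del: transpose_matrix_vector)
qed

text \<open>The observable is only assumed differentiable, because it is also going to be the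
  Hamiltonian, for which \<open>hamiltonian_has_derivative\<close> provides just a first derivative.\<close>

lemma observable_along_solution:
  fixes F :: "'a::euclidean_space \<times> 'b::euclidean_space \<Rightarrow> real"
  assumes F: "F differentiable (at (z t))"
    and z: "(z has_vector_derivative X) (at t within T)"
  shows "((\<lambda>s. F (z s)) has_real_derivative (grad_fst F (z t), grad_snd F (z t)) \<bullet> X) (at t within T)"
proof -
  let ?g = "(grad_fst F (z t), grad_snd F (z t))"
  have "(F has_derivative (\<lambda>h. ?g \<bullet> h)) (at (z t))"
    using has_derivative_partial_gradients[OF F] by (simp add: inner_prod_def)
  with z have "((\<lambda>s. F (z s)) has_derivative (\<lambda>s. ?g \<bullet> (s *\<^sub>R X))) (at t within T)"
    unfolding has_vector_derivative_def by (rule has_derivative_compose)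
  then show ?thesis
    by (simp add: has_field_derivative_def mult_commute_abs)
qed

lemma has_vector_derivative_componentwiseI:
  fixes z :: "real \<Rightarrow> 'a::euclidean_space"
  assumes "\<And>e. e \<in> Basis \<Longrightarrow> ((\<lambda>s. z s \<bullet> e) has_real_derivative X \<bullet> e) (at t within T)"
  shows "(z has_vector_derivative X) (at t within T)"
  unfolding has_vector_derivative_def
proof (subst has_derivative_componentwise_within, intro ballI)
  fix e :: 'a assume "e \<in> Basis"
  from assms[OF this] show "((\<lambda>s. z s \<bullet> e) has_derivative (\<lambda>s. (s *\<^sub>R X) \<bullet> e)) (at t within T)"
    by (simp add: has_field_derivative_def mult_commute_abs)
qed

lemma at_within_interval_neq_bot:
  fixes T :: "real set"
  assumes "is_interval T" "interior T \<noteq> {}" "t \<in> T"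
  shows "at t within T \<noteq> bot"
proof -
  have "T \<noteq> {x}" for x
    using assms(2) by auto
  then have "t islimpt T"
    using assms by (intro connected_imp_perfect) (auto simp: is_interval_connected)
  then show ?thesis
    by (simp add: trivial_limit_within)
qed

section \<open>The metriplectic formulation\<close>

theorem mainTheorem1:
  fixes \<G> :: "real^'n0^'n1" and \<C> :: "real^'n1^'n2"
    and H0 :: "real^'n0^'n0" and H1 :: "real^'n1^'n1" and b :: real
    and K :: "(real^'n0) \<times> (real^'n1) \<Rightarrow> real"
    and U W :: "((real^'n0) \<times> (real^'n1)) set"
  assumes curl_grad: "\<C> ** \<G> = 0"
    and H0_sym: "transpose H0 = H0"
    and H1_sym: "transpose H1 = H1"
    and b_nonneg: "0 \<le> b"
    and U_open: "open U"
    and K_smooth: "smooth_on U K"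
    and W_open: "open W"
    and diffeo: "diffeomorphism_onto (density_velocity H0 K) U W"
  defines "p \<equiv> pressure_of H0 K U"
    and "m \<equiv> momentum_of H0 H1 K U"
    and "H \<equiv> hamiltonian H0 H1 K U"
  shows "(\<forall>w\<in>W. H differentiable (at w) \<and> grad_fst H w = p w \<and> grad_snd H w = m w)
    \<and> (\<forall>T z. is_interval T \<and> interior T \<noteq> {} \<and> (\<forall>t\<in>T. z t \<in> W) \<longrightarrow>
         (evolves_by_brackets b \<G> H1 W H T z \<longleftrightarrow> solves_acoustic_system b \<G> H0 H1 K U T z))
    \<and> (\<forall>T z. is_interval T \<and> interior T \<noteq> {} \<and> (\<forall>t\<in>T. z t \<in> W)
           \<and> solves_acoustic_system b \<G> H0 H1 K U T z \<longrightarrow>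
         (\<forall>t\<in>T.
           ((\<lambda>s. H (z s)) has_real_derivative
              - b * (p (z t) \<bullet> ((transpose \<G> ** H1 ** \<G>) *v p (z t)))) (at t within T)
           \<and> \<C> *v vector_derivative (\<lambda>s. snd (z s)) (at t within T) = 0))"
proof -
  let ?X = "\<lambda>w. block_apply (- b *\<^sub>R (transpose \<G> ** H1 ** \<G>)) (transpose \<G>) (- \<G>) 0 (p w, m w)"
  have dH: "(H has_derivative (\<lambda>h. p w \<bullet> fst h + m w \<bullet> snd h)) (at w)" if "w \<in> W" for w
    unfolding H_def p_def m_def
    by (rule hamiltonian_has_derivative[OF H0_sym H1_sym K_smooth diffeo that])
  have H: "H differentiable (at w)" "grad_fst H w = p w" "grad_snd H w = m w" if "w \<in> W" for w
    using dH[OF that] partial_gradients_eqI[OF dH[OF that]] by (auto simp: differentiable_def)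
  have brackets: "poisson_bracket \<G> F H w + dissipative_bracket b \<G> H1 F H w
      = (grad_fst F w, grad_snd F w) \<bullet> ?X w" if "w \<in> W" for F w
    by (simp add: brackets_eq_vector_field H that)
  have solves: "solves_acoustic_system b \<G> H0 H1 K U T z \<longleftrightarrow>
      (\<forall>t\<in>T. (z has_vector_derivative ?X (z t)) (at t within T))" for T z
    by (simp add: solves_acoustic_system_def p_def m_def)

  have rule_iff: "evolves_by_brackets b \<G> H1 W H T z \<longleftrightarrow> solves_acoustic_system b \<G> H0 H1 K U T z"
    if zW: "\<forall>t\<in>T. z t \<in> W" for T z
  proof
    assume ev: "evolves_by_brackets b \<G> H1 W H T z"
    show "solves_acoustic_system b \<G> H0 H1 K U T z"
      unfolding solves
    proof (intro ballI has_vector_derivative_componentwiseI)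
      fix t and e :: "(real^'n0) \<times> (real^'n1)"
      assume t: "t \<in> T"
      \<comment> \<open>The rule for this observable is the component of the system in direction \<open>e\<close>.\<close>
      let ?F = "\<lambda>w. w \<bullet> e"
      have lin: "bounded_linear ?F"
        by (rule bounded_linear_inner_left)
      have "(?F has_derivative (\<lambda>h. fst e \<bullet> fst h + snd e \<bullet> snd h)) (at (z t))"
        using bounded_linear_imp_has_derivative[OF lin, of "at (z t)"]
        by (simp add: inner_prod_def inner_commute)
      note grad = partial_gradients_eqI[OF this]
      have "((\<lambda>s. ?F (z s)) has_real_derivative
          poisson_bracket \<G> ?F H (z t) + dissipative_bracket b \<G> H1 ?F H (z t)) (at t within T)"
        by (rule ev[unfolded evolves_by_brackets_def, rule_format,
              OF smooth_on_bounded_linear[OF lin] t])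
      then show "((\<lambda>s. z s \<bullet> e) has_real_derivative ?X (z t) \<bullet> e) (at t within T)"
        using zW t by (simp add: brackets grad inner_commute)
    qed
  next
    assume "solves_acoustic_system b \<G> H0 H1 K U T z"
    then show "evolves_by_brackets b \<G> H1 W H T z"
      unfolding evolves_by_brackets_def solves
      by (intro allI impI ballI, subst brackets)
         (use zW in \<open>auto intro!: observable_along_solution intro: smooth_on_imp_differentiable\<close>)
  qed

  have dissipation: "((\<lambda>s. H (z s)) has_real_derivative
        - b * (p (z t) \<bullet> ((transpose \<G> ** H1 ** \<G>) *v p (z t)))) (at t within T)"
    and conservation: "\<C> *v vector_derivative (\<lambda>s. snd (z s)) (at t within T) = 0"
    if T: "is_interval T" "interior T \<noteq> {}" and zW: "\<forall>t\<in>T. z t \<in> W"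
      and sol: "solves_acoustic_system b \<G> H0 H1 K U T z" and t: "t \<in> T" for T z t
  proof -
    have w: "z t \<in> W" and z: "(z has_vector_derivative ?X (z t)) (at t within T)"
      using zW sol t by (auto simp: solves)
    have adj: "p (z t) \<bullet> (transpose \<G> *v y) = (\<G> *v p (z t)) \<bullet> y" for y
      by (metis dot_lmul_matrix inner_commute transpose_matrix_vector)
    have "(grad_fst H (z t), grad_snd H (z t)) \<bullet> ?X (z t)
        = - b * (p (z t) \<bullet> ((transpose \<G> ** H1 ** \<G>) *v p (z t)))"
      unfolding brackets[OF w, symmetric]
      by (simp add: poisson_bracket_def dissipative_bracket_def H[OF w] adj
          matrix_vector_mul_assoc[symmetric] del: transpose_matrix_vector)
    with observable_along_solution[OF H(1)[OF w] z]
    show "((\<lambda>s. H (z s)) has_real_derivative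
        - b * (p (z t) \<bullet> ((transpose \<G> ** H1 ** \<G>) *v p (z t)))) (at t within T)"
      by simp
    have "((\<lambda>s. snd (z s)) has_vector_derivative snd (?X (z t))) (at t within T)"
      by (rule bounded_linear.has_vector_derivative[OF bounded_linear_snd z])
    then have "((\<lambda>s. snd (z s)) has_vector_derivative - (\<G> *v p (z t))) (at t within T)"
      by (simp only: block_apply_acoustic snd_conv)
    then have "vector_derivative (\<lambda>s. snd (z s)) (at t within T) = - (\<G> *v p (z t))"
      by (rule vector_derivative_within[OF at_within_interval_neq_bot[OF T t]])
    then show "\<C> *v vector_derivative (\<lambda>s. snd (z s)) (at t within T) = 0"
      by (simp add: vec.neg matrix_vector_mul_assoc curl_grad)
  qed
  show ?thesis
    by (intro conjI allI impI ballI; (elim conjE)?)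
       (rule H rule_iff dissipation conservation; assumption)+
qed

end
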